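(* Let $G$ be a finite group and let $\varphi$ be a fixed-point-free endomorphism of $G$. The following are equivalent: (1) $\varphi$ is quasi-invertible; (2) $\varphi$ is abelian.
   Context: Groups are written multiplicatively and maps are written as exponents. For maps $\alpha,\beta : G \to G$, the maps $\alpha+\beta$, $-\alpha$ and $\alpha-\beta = \alpha + (-\beta)$ are defined pointwise by $x^{\alpha+\beta} = x^{\alpha}x^{\beta}$, $x^{-\alpha} = (x^{\alpha})^{-1}$, and the product is composition, $x^{\alpha\beta} = (x^{\alpha})^{\beta}$. The symbol $1$, used as a map, denotes the identity map of $G$; thus $x^{1-\varphi} = x\,(x^{\varphi})^{-1}$. An endomorphism $\varphi$ of $G$ is fixed-point-free if the only $x\in G$ with $x^{\varphi}=x$ is $x=1$. An endomorphism $\varphi$ of $G$ is abelian if its image $G^{\varphi}$ is abelian. A fixed-point-free endomorphism $\varphi$ of a finite group $G$ is quasi-invertible if there is an endomorphism $\psi$ of $G$ such that the map $1-\psi$ is the inverse of the map $1-\varphi$ with respect to composition of maps on $G$; such $\psi$ is then called the quasi-inverse of $\varphi$. *)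

theory Defs
  imports "HOL-Algebra.Group"
begin

text \<open>
  Endomorphisms of \<open>G\<close> are the elements of \<open>hom G G\<close>; as usual in this library, only their
  values on \<open>carrier G\<close> matter. The exponent notation $x^\varphi$ becomes \<open>\<phi> x\<close>.
\<close>

definition map_diff ::
  "('a, 'b) monoid_scheme \<Rightarrow> ('a \<Rightarrow> 'a) \<Rightarrow> ('a \<Rightarrow> 'a) \<Rightarrow> 'a \<Rightarrow> 'a"
  where "map_diff G \<alpha> \<beta> = (\<lambda>x. \<alpha> x \<otimes>\<^bsub>G\<^esub> inv\<^bsub>G\<^esub> (\<beta> x))"

definition fixed_point_free :: "('a, 'b) monoid_scheme \<Rightarrow> ('a \<Rightarrow> 'a) \<Rightarrow> bool"
  where "fixed_point_free G \<phi> \<longleftrightarrow> (\<forall>x \<in> carrier G. \<phi> x = x \<longrightarrow> x = \<one>\<^bsub>G\<^esub>)"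

definition abelian_endomorphism :: "('a, 'b) monoid_scheme \<Rightarrow> ('a \<Rightarrow> 'a) \<Rightarrow> bool"
  where "abelian_endomorphism G \<phi> \<longleftrightarrow> \<phi> \<in> hom G G \<and> comm_group (G\<lparr>carrier := \<phi> ` carrier G\<rparr>)"

text \<open>
  Being inverse to each other means two-sided inverse under composition of maps on
  \<open>carrier G\<close>. The map written $1$ is \<open>id\<close>.
\<close>

definition inverse_maps_on :: "'a set \<Rightarrow> ('a \<Rightarrow> 'a) \<Rightarrow> ('a \<Rightarrow> 'a) \<Rightarrow> bool"
  where "inverse_maps_on A f g \<longleftrightarrow>
    f \<in> A \<rightarrow> A \<and> g \<in> A \<rightarrow> A \<and> (\<forall>x \<in> A. (g \<circ> f) x = x) \<and> (\<forall>x \<in> A. (f \<circ> g) x = x)"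

definition quasi_inverse :: "('a, 'b) monoid_scheme \<Rightarrow> ('a \<Rightarrow> 'a) \<Rightarrow> ('a \<Rightarrow> 'a) \<Rightarrow> bool"
  where "quasi_inverse G \<phi> \<psi> \<longleftrightarrow>
    \<psi> \<in> hom G G \<and> inverse_maps_on (carrier G) (map_diff G id \<phi>) (map_diff G id \<psi>)"

definition quasi_invertible :: "('a, 'b) monoid_scheme \<Rightarrow> ('a \<Rightarrow> 'a) \<Rightarrow> bool"
  where "quasi_invertible G \<phi> \<longleftrightarrow>
    \<phi> \<in> hom G G \<and> fixed_point_free G \<phi> \<and> (\<exists>\<psi>. quasi_inverse G \<phi> \<psi>)"

end

theory Submission
  imports Defs
begin

text \<open>
  Write \<open>\<delta> = 1 - \<phi>\<close>, that is \<open>\<delta> x = x (\<phi> x)\<inverse>\<close>. Fixed-point-freeness makes \<open>\<delta>\<close> injective, hence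
  bijective because \<open>G\<close> is finite, so \<open>1 - \<psi> = \<delta>\<inverse>\<close> determines \<open>\<psi>\<close> as a map: \<open>\<psi> (\<delta> y) = (\<phi> y)\<inverse>\<close>.
  The only question is whether \<open>\<psi>\<close> is multiplicative. Every product of values of \<open>\<delta>\<close> has the form
  \<open>\<delta> a \<delta> b = c (\<phi> b \<phi> a)\<inverse>\<close> with \<open>c = a (\<phi> a)\<inverse> b \<phi> a\<close> (\<open>map_diff_mult\<close>), and multiplicativity
  of \<open>\<psi>\<close> amounts to \<open>\<phi> c = \<phi> b \<phi> a\<close> for all \<open>a\<close> and \<open>b\<close>.

  If the image \<open>H\<close> of \<open>\<phi>\<close> is abelian, this holds because conjugation by \<open>\<phi> (\<phi> a)\<close> is trivial on
  \<open>H\<close>. Conversely, with \<open>A = \<phi> a\<close> and \<open>B = \<phi> b\<close> the condition reads \<open>A (\<phi> A)\<inverse> B \<phi> A = B A\<close>, which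
  says that \<open>\<delta> A\<close> commutes with \<open>B\<close>. As \<open>\<delta>\<close> maps the finite set \<open>H\<close> injectively into itself,
  every element of \<open>H\<close> is some \<open>\<delta> A\<close>, and so \<open>H\<close> is abelian.
\<close>

context group
begin

lemma map_diff_id_closed:
  assumes "\<phi> \<in> hom G G" "x \<in> carrier G"
  shows "map_diff G id \<phi> x \<in> carrier G"
  using assms by (simp add: map_diff_def hom_in_carrier)

text \<open>
  Two points with the same value of \<open>1 - \<phi>\<close> differ by a fixed point of \<open>\<phi>\<close>.
\<close>

lemma inj_on_map_diff_id:
  assumes hom: "\<phi> \<in> hom G G" and fpf: "fixed_point_free G \<phi>"
  shows "inj_on (map_diff G id \<phi>) (carrier G)"
proof (rule inj_onI)
  fix x y
  assume x: "x \<in> carrier G" and y: "y \<in> carrier G"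
    and eq: "map_diff G id \<phi> x = map_diff G id \<phi> y"
  interpret \<phi>: group_hom G G \<phi>
    using hom by unfold_locales
  have "x = y \<otimes> inv (\<phi> y) \<otimes> \<phi> x"
    using eq x y by (simp add: map_diff_def inv_solve_right')
  then have "inv y \<otimes> x = \<phi> (inv y \<otimes> x)"
    using x y by (metis \<phi>.hom_closed \<phi>.hom_inv \<phi>.hom_mult inv_closed inv_solve_left m_assoc m_closed)
  then have "inv y \<otimes> x = \<one>"
    using fpf x y unfolding fixed_point_free_def by (metis inv_closed m_closed)
  then show "x = y"
    using x y by (metis inv_closed inv_equality inv_inv)
qed

text \<open>
  The failure of \<open>1 - \<phi>\<close> to be multiplicative. The right-hand side is the value of \<open>1 - \<phi>\<close> at
  \<open>a (\<phi> a)\<inverse> b \<phi> a\<close> exactly when \<open>\<phi>\<close> sends that element to \<open>\<phi> b \<phi> a\<close>.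
\<close>

lemma map_diff_mult:
  assumes "\<phi> \<in> hom G G" "a \<in> carrier G" "b \<in> carrier G"
  shows "map_diff G id \<phi> a \<otimes> map_diff G id \<phi> b =
    (a \<otimes> inv (\<phi> a) \<otimes> b \<otimes> \<phi> a) \<otimes> inv (\<phi> b \<otimes> \<phi> a)"
proof -
  have [simp]: "\<phi> a \<in> carrier G" "\<phi> b \<in> carrier G"
    using assms by (auto simp: hom_in_carrier)
  have "\<phi> a \<otimes> (inv (\<phi> a) \<otimes> inv (\<phi> b)) = inv (\<phi> b)"
    by (simp flip: m_assoc)
  then show ?thesis
    using assms(2,3) by (simp add: map_diff_def inv_mult_group m_assoc)
qed

lemma quasi_inverse_map_diff:
  assumes hom: "\<phi> \<in> hom G G" and qi: "quasi_inverse G \<phi> \<psi>" and y: "y \<in> carrier G"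
  shows "\<psi> (map_diff G id \<phi> y) = inv (\<phi> y)"
proof -
  let ?d = "map_diff G id \<phi> y"
  have d: "?d \<in> carrier G" and \<psi>d: "\<psi> ?d \<in> carrier G" and \<phi>y: "\<phi> y \<in> carrier G"
    using hom qi y by (auto simp: quasi_inverse_def map_diff_id_closed hom_in_carrier)
  have "?d \<otimes> inv (\<psi> ?d) = y"
    using qi y by (simp add: quasi_inverse_def inverse_maps_on_def map_diff_def)
  then have "y \<otimes> \<psi> ?d = y \<otimes> inv (\<phi> y)"
    using d \<psi>d y by (metis inv_solve_right' map_diff_def id_apply)
  then show ?thesis
    using y \<psi>d \<phi>y by simp
qed

text \<open>
  For multiplicative \<open>\<psi>\<close>, the element \<open>c\<close> with \<open>\<delta> c = \<delta> a \<delta> b\<close> satisfies \<open>\<phi> c = \<phi> b \<phi> a\<close>, and this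
  determines \<open>c\<close>; computing \<open>\<phi> c\<close> from the resulting formula gives the commutation.
\<close>

lemma quasi_inverse_imp_commute:
  assumes hom: "\<phi> \<in> hom G G" and qi: "quasi_inverse G \<phi> \<psi>"
    and A: "A \<in> \<phi> ` carrier G" and B: "B \<in> \<phi> ` carrier G"
  shows "map_diff G id \<phi> A \<otimes> B = B \<otimes> map_diff G id \<phi> A"
proof -
  interpret \<phi>: group_hom G G \<phi>
    using hom by unfold_locales
  let ?\<delta> = "map_diff G id \<phi>" and ?\<epsilon> = "map_diff G id \<psi>"
  obtain a b where a: "a \<in> carrier G" "A = \<phi> a" and b: "b \<in> carrier G" "B = \<phi> b"
    using A B by blast
  have \<psi>: "\<psi> \<in> hom G G"
    using qi by (simp add: quasi_inverse_def)
  define c where "c = ?\<epsilon> (?\<delta> a \<otimes> ?\<delta> b)"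
  have c: "c \<in> carrier G" and \<delta>c: "?\<delta> c = ?\<delta> a \<otimes> ?\<delta> b"
    using qi a(1) b(1) map_diff_id_closed[OF hom] map_diff_id_closed[OF \<psi>]
    by (auto simp: c_def quasi_inverse_def inverse_maps_on_def)
  have "inv (\<phi> c) = \<psi> (?\<delta> a) \<otimes> \<psi> (?\<delta> b)"
    using quasi_inverse_map_diff[OF hom qi c] \<delta>c a(1) b(1) map_diff_id_closed[OF hom] hom_mult[OF \<psi>]
    by simp
  also have "\<dots> = inv (\<phi> b \<otimes> \<phi> a)"
    using quasi_inverse_map_diff[OF hom qi] a(1) b(1) by (simp add: inv_mult_group)
  finally have \<phi>c: "\<phi> c = \<phi> b \<otimes> \<phi> a"
    using a(1) b(1) c by (metis \<phi>.hom_closed inv_inv m_closed)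
  have "c \<otimes> inv (\<phi> b \<otimes> \<phi> a) = (a \<otimes> inv (\<phi> a) \<otimes> b \<otimes> \<phi> a) \<otimes> inv (\<phi> b \<otimes> \<phi> a)"
    using map_diff_mult[OF hom a(1) b(1)] \<delta>c \<phi>c by (simp add: map_diff_def)
  then have "c = a \<otimes> inv (\<phi> a) \<otimes> b \<otimes> \<phi> a"
    using a(1) b(1) c by simp
  then have "B \<otimes> A = A \<otimes> inv (\<phi> A) \<otimes> B \<otimes> \<phi> A"
    using \<phi>c a b by simp
  then have "B \<otimes> A \<otimes> inv (\<phi> A) = A \<otimes> inv (\<phi> A) \<otimes> B"
    using a b by (simp add: inv_solve_right')
  then show ?thesis
    using a b by (simp add: map_diff_def m_assoc)
qed

lemma quasi_inverse_imp_abelian: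
  assumes fin: "finite (carrier G)" and hom: "\<phi> \<in> hom G G" and fpf: "fixed_point_free G \<phi>"
    and qi: "quasi_inverse G \<phi> \<psi>"
  shows "abelian_endomorphism G \<phi>"
proof -
  interpret \<phi>: group_hom G G \<phi>
    using hom by unfold_locales
  let ?H = "\<phi> ` carrier G" and ?\<delta> = "map_diff G id \<phi>"
  have H: "subgroup ?H G"
    by (rule \<phi>.img_is_subgroup)
  have "?\<delta> ` ?H \<subseteq> ?H"
    using subgroup.m_closed[OF H] subgroup.m_inv_closed[OF H]
    by (auto simp: map_diff_def)
  moreover have "inj_on ?\<delta> ?H"
    using inj_on_map_diff_id[OF hom fpf] by (rule inj_on_subset) auto
  ultimately have onto: "?\<delta> ` ?H = ?H"
    using fin by (simp add: endo_inj_surj)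
  have comm: "C \<otimes> B = B \<otimes> C" if "C \<in> ?H" "B \<in> ?H" for B C
  proof -
    obtain A where "A \<in> ?H" "C = ?\<delta> A"
      using onto \<open>C \<in> ?H\<close> by (metis imageE)
    then show ?thesis
      using quasi_inverse_imp_commute[OF hom qi] \<open>B \<in> ?H\<close> by simp
  qed
  interpret H: group "G\<lparr>carrier := ?H\<rparr>"
    using H is_group by (rule subgroup.subgroup_is_group)
  have "comm_group (G\<lparr>carrier := ?H\<rparr>)"
    by (rule H.group_comm_groupI) (use comm in simp)
  with hom show ?thesis
    by (simp add: abelian_endomorphism_def)
qed

lemma abelian_imp_quasi_inverse:
  assumes fin: "finite (carrier G)" and hom: "\<phi> \<in> hom G G" and fpf: "fixed_point_free G \<phi>"
    and ab: "abelian_endomorphism G \<phi>"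
  shows "\<exists>\<psi>. quasi_inverse G \<phi> \<psi>"
proof -
  interpret \<phi>: group_hom G G \<phi>
    using hom by unfold_locales
  let ?\<delta> = "map_diff G id \<phi>"
  have "comm_monoid (G\<lparr>carrier := \<phi> ` carrier G\<rparr>)"
    using ab by (simp add: abelian_endomorphism_def comm_group_def)
  then have comm: "\<phi> x \<otimes> \<phi> y = \<phi> y \<otimes> \<phi> x" if "x \<in> carrier G" "y \<in> carrier G" for x y
    using that comm_monoid.m_comm[of _ "\<phi> x" "\<phi> y"] by fastforce
  have closed: "?\<delta> x \<in> carrier G" if "x \<in> carrier G" for x
    using hom that by (rule map_diff_id_closed)
  have inj: "inj_on ?\<delta> (carrier G)"
    using hom fpf by (rule inj_on_map_diff_id)
  have onto: "?\<delta> ` carrier G = carrier G"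
    using fin inj closed by (simp add: endo_inj_surj image_subset_iff)
  define g where "g = inv_into (carrier G) ?\<delta>"
  have g_closed: "g x \<in> carrier G" and \<delta>_g: "?\<delta> (g x) = x" if "x \<in> carrier G" for x
    using that onto by (auto simp: g_def inv_into_into f_inv_into_f)
  have g_\<delta>: "g (?\<delta> x) = x" if "x \<in> carrier G" for x
    using that inj by (simp add: g_def)
  \<comment> \<open>The value of \<open>\<psi>\<close> at \<open>x = \<delta> y\<close> must be \<open>(\<phi> y)\<inverse>\<close>, and \<open>y = g x\<close>.\<close>
  define \<psi> where "\<psi> = (\<lambda>x. inv (\<phi> (g x)))"
  have mult: "\<psi> (x \<otimes> y) = \<psi> x \<otimes> \<psi> y" if x: "x \<in> carrier G" and y: "y \<in> carrier G" for x y
  proof -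
    define a b where "a = g x" and "b = g y"
    have a [simp]: "a \<in> carrier G" and b [simp]: "b \<in> carrier G"
      using x y g_closed by (auto simp: a_def b_def)
    define c where "c = a \<otimes> inv (\<phi> a) \<otimes> b \<otimes> \<phi> a"
    have c: "c \<in> carrier G"
      by (simp add: c_def)
    \<comment> \<open>The conjugation of \<open>\<phi> b\<close> by \<open>\<phi> (\<phi> a)\<close> disappears, since both lie in the abelian image.\<close>
    have "\<phi> c = \<phi> a \<otimes> (inv (\<phi> (\<phi> a)) \<otimes> (\<phi> b \<otimes> \<phi> (\<phi> a)))"
      by (simp add: c_def m_assoc)
    also have "\<phi> b \<otimes> \<phi> (\<phi> a) = \<phi> (\<phi> a) \<otimes> \<phi> b"
      by (simp add: comm)
    also have "\<phi> a \<otimes> (inv (\<phi> (\<phi> a)) \<otimes> (\<phi> (\<phi> a) \<otimes> \<phi> b)) = \<phi> a \<otimes> \<phi> b"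
      by (simp flip: m_assoc[of "inv (\<phi> (\<phi> a))"])
    also have "\<dots> = \<phi> b \<otimes> \<phi> a"
      by (simp add: comm)
    finally have \<phi>c: "\<phi> c = \<phi> b \<otimes> \<phi> a" .
    have "x \<otimes> y = ?\<delta> a \<otimes> ?\<delta> b"
      using x y by (simp add: a_def b_def \<delta>_g)
    also have "\<dots> = ?\<delta> c"
      using map_diff_mult[OF hom a b] \<phi>c by (simp add: map_diff_def c_def)
    finally have "g (x \<otimes> y) = c"
      using c by (simp add: g_\<delta>)
    then show ?thesis
      using \<phi>c by (simp add: \<psi>_def inv_mult_group flip: a_def b_def)
  qed
  have \<psi>: "\<psi> \<in> hom G G"
    using mult g_closed by (auto simp: hom_def \<psi>_def)
  have g_eq: "map_diff G id \<psi> x = g x" if x: "x \<in> carrier G" for x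
  proof -
    have "g x \<otimes> inv (\<phi> (g x)) = x"
      using \<delta>_g[OF x] by (simp add: map_diff_def)
    then have "g x = x \<otimes> \<phi> (g x)"
      using x g_closed[OF x] by (simp add: inv_solve_right')
    then show ?thesis
      using x g_closed[OF x] by (simp add: map_diff_def \<psi>_def)
  qed
  have "inverse_maps_on (carrier G) ?\<delta> (map_diff G id \<psi>)"
    using closed g_closed g_\<delta> \<delta>_g g_eq by (simp add: inverse_maps_on_def)
  with \<psi> show ?thesis
    by (auto simp: quasi_inverse_def)
qed

end

theorem theorem3p4:
  fixes G :: "('a, 'b) monoid_scheme" and \<phi> :: "'a \<Rightarrow> 'a"
  assumes "group G"
    and "finite (carrier G)"
    and "\<phi> \<in> hom G G"
    and "fixed_point_free G \<phi>"
  shows "quasi_invertible G \<phi> \<longleftrightarrow> abelian_endomorphism G \<phi>"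
  using assms group.quasi_inverse_imp_abelian[OF assms(1-4)]
    group.abelian_imp_quasi_inverse[OF assms(1-4)]
  unfolding quasi_invertible_def by blast

end
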